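(* For every pair of positive integers $(\ell,k)$ with $\ell\le k$, \[a_{k, \ell}\ge \frac{2}{\ell\left(1+\sqrt{1-\frac{4(\ell-1)}{\ell^2\binom{k}{\ell}}}\right)}.\]
   Context: Let $H_{n,k}=\{0,1,\dots,n-1\}^k$. For $\ell\le k$, an $\ell$-rook is a point $P\in H_{n,k}$ together with a set $D$ of $\ell$ of the $k$ coordinate indices; it covers $P$ itself and every point of $H_{n,k}$ which differs from $P$ in exactly one coordinate, that coordinate belonging to $D$. Distinct rooks must occupy distinct points. $a_{n,k,\ell}$ is the minimum number of $\ell$-rooks whose covered sets together cover $H_{n,k}$, and $a_{k,\ell}=\lim_{n\to\infty} a_{n,k,\ell}/n^{k-1}$ (this limit exists). *)

theory Defs
  imports "HOL-Analysis.Analysis"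
begin

definition hcube :: "nat \<Rightarrow> nat \<Rightarrow> (nat \<Rightarrow> nat) set" where
  "hcube n k = {..<k} \<rightarrow>\<^sub>E {..<n}"

definition rooks :: "nat \<Rightarrow> nat \<Rightarrow> nat \<Rightarrow> ((nat \<Rightarrow> nat) \<times> nat set) set" where
  "rooks n k l = hcube n k \<times> {D. D \<subseteq> {..<k} \<and> card D = l}"

definition covered :: "nat \<Rightarrow> nat \<Rightarrow> (nat \<Rightarrow> nat) \<times> nat set \<Rightarrow> (nat \<Rightarrow> nat) set" where
  "covered n k = (\<lambda>(P, D).
     {Q \<in> hcube n k. Q = P \<or> (\<exists>d\<in>D. {i \<in> {..<k}. Q i \<noteq> P i} = {d})})"

text \<open>Injectivity of \<^const>\<open>fst\<close> says that distinct rooks occupy distinct points.\<close>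

definition rook_covering :: "nat \<Rightarrow> nat \<Rightarrow> nat \<Rightarrow> ((nat \<Rightarrow> nat) \<times> nat set) set \<Rightarrow> bool" where
  "rook_covering n k l R \<longleftrightarrow>
     R \<subseteq> rooks n k l \<and> inj_on fst R \<and> (\<Union>r\<in>R. covered n k r) = hcube n k"

text \<open>For \<open>l \<le> k\<close> the minimum exists: placing one rook on every point is a covering.
  Every covering is finite, since \<^term>\<open>rooks n k l\<close> is.\<close>

definition min_rooks :: "nat \<Rightarrow> nat \<Rightarrow> nat \<Rightarrow> nat" where
  "min_rooks n k l = (LEAST m. \<exists>R. rook_covering n k l R \<and> card R = m)"

definition rook_density :: "nat \<Rightarrow> nat \<Rightarrow> real" where
  "rook_density k l = lim (\<lambda>n. real (min_rooks n k l) / real n ^ (k - 1))"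

end

theory Submission
  imports Defs
begin

text \<open>Blowing up a covering of the cube of side \<open>n\<close> along a diagonal set shows that
  \<open>min_rooks n k l / n ^ (k - 1)\<close> converges to its infimum, so it suffices to bound each term.

  Fix a covering by \<open>x n ^ (k - 1)\<close> rooks, and count for every point the rooks covering it along
  each line. The average count is \<open>l x\<close>, so the excess over \<open>1\<close> averages \<open>l x - 1\<close>. A point hit by
  rooks of one type \<open>D\<close> along \<open>j \<ge> 1\<close> of its lines contributes \<open>j - 1 \<ge> j (j - 1) / l\<close> to the
  excess. The pairs of lines in directions \<open>d, d' \<in> D\<close> that are both hit are counted plane by
  plane: a plane with \<open>m\<close> rooks in general position has \<open>m\<^sup>2\<close> of them, and every coincidence on a
  line is itself excess. By convexity the excess is at least \<open>(l - 1) x\<^sup>2 / (k choose l)\<close>, a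
  quadratic inequality in \<open>x\<close> whose smaller root is the claimed bound.\<close>

section \<open>Covering by lines\<close>

lemma finite_hcube [simp]: "finite (hcube n k)"
  by (simp add: hcube_def finite_PiE)

lemma card_hcube: "card (hcube n k) = n ^ k"
  by (simp add: hcube_def card_PiE)

lemma hcube_less: "Q \<in> hcube n k \<Longrightarrow> i < k \<Longrightarrow> Q i < n"
  by (auto simp: hcube_def)

lemma hcube_upd: "Q \<in> hcube n k \<Longrightarrow> d < k \<Longrightarrow> a < n \<Longrightarrow> Q(d := a) \<in> hcube n k"
  by (auto simp: hcube_def PiE_iff extensional_def)

lemma hcube_eqI:
  "P \<in> hcube n k \<Longrightarrow> Q \<in> hcube m k \<Longrightarrow> (\<And>i. i < k \<Longrightarrow> P i = Q i) \<Longrightarrow> P = Q"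
  by (rule extensionalityI[of _ "{..<k}"]) (auto simp: hcube_def PiE_iff)

text \<open>Coverage becomes incidence with an axis-parallel line through \<open>Q\<close>, the form
  that the counting needs. The case \<open>Q = P\<close> is absorbed because \<open>P\<close> lies
  on each of its own lines, which takes a nonempty \<open>D\<close>.\<close>

lemma covered_iff:
  assumes "P \<in> hcube n k" "Q \<in> hcube n k" "D \<subseteq> {..<k}" "D \<noteq> {}"
  shows "Q \<in> covered n k (P, D) \<longleftrightarrow> (\<exists>d\<in>D. P = Q(d := P d))"
proof
  assume "Q \<in> covered n k (P, D)"
  then consider "Q = P" | d where "d \<in> D" "{i \<in> {..<k}. Q i \<noteq> P i} = {d}"
    by (auto simp: covered_def)
  then show "\<exists>d\<in>D. P = Q(d := P d)"
  proof cases
    case 1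
    with assms show ?thesis by auto
  next
    case 2
    then have "P = Q(d := P d)"
      using assms by (intro hcube_eqI[of P n k _ n] hcube_upd) (auto intro: hcube_less)
    with 2 show ?thesis by blast
  qed
next
  assume "\<exists>d\<in>D. P = Q(d := P d)"
  then obtain d where d: "d \<in> D" "P = Q(d := P d)" by blast
  have off: "Q i = P i" if "i \<noteq> d" for i
    using d(2) that by (metis fun_upd_other)
  show "Q \<in> covered n k (P, D)"
  proof (cases "Q d = P d")
    case True
    with d(2) have "Q = P" by (metis fun_upd_triv)
    with assms show ?thesis by (simp add: covered_def)
  next
    case False
    with off d(1) assms have "{i \<in> {..<k}. Q i \<noteq> P i} = {d}" by auto
    with d(1) assms show ?thesis by (auto simp: covered_def)
  qed
qed

lemma finite_rooks [simp]: "finite (rooks n k l)"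
  unfolding rooks_def by (intro finite_cartesian_product) auto

lemma min_rooks_attained:
  assumes "1 \<le> l" "l \<le> k"
  obtains R where "rook_covering n k l R" "card R = min_rooks n k l"
proof -
  let ?R = "(\<lambda>P. (P, {..<l})) ` hcube n k"
  have "rook_covering n k l ?R"
    using assms by (auto simp: rook_covering_def rooks_def covered_def inj_on_def)
  then have "\<exists>m R. rook_covering n k l R \<and> card R = m" by blast
  then have "\<exists>R. rook_covering n k l R \<and> card R = min_rooks n k l"
    unfolding min_rooks_def by (rule LeastI_ex)
  with that show thesis by blast
qed

lemma min_rooks_le: "rook_covering n k l R \<Longrightarrow> min_rooks n k l \<le> card R"
  unfolding min_rooks_def by (rule Least_le) blast

section \<open>Existence of the limit\<close>

text \<open>Sends the grid \<open>{..<n} \<times> {..N div n}\<close> onto \<open>{..<N}\<close>, respecting residues modulo \<open>n\<close>.\<close>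

definition spread :: "nat \<Rightarrow> nat \<Rightarrow> nat \<Rightarrow> nat \<Rightarrow> nat" where
  "spread n N c x = (if c + n * x < N then c + n * x else c)"

lemma spread_less: "c < n \<Longrightarrow> n \<le> N \<Longrightarrow> spread n N c x < N"
  by (simp add: spread_def)

lemma spread_mod: "c < n \<Longrightarrow> spread n N c x mod n = c"
  by (simp add: spread_def)

lemma spread_mod_div: "t < N \<Longrightarrow> spread n N (t mod n) (t div n) = t"
  by (simp add: spread_def)

section \<open>Diagonal sets and blow-ups of coverings\<close>

text \<open>The single parity check code modulo \<open>m\<close>: for positive \<open>m\<close> it
  meets every axis-parallel line of the cube in exactly one point.\<close>

definition diagonal :: "nat \<Rightarrow> nat \<Rightarrow> (nat \<Rightarrow> nat) set" where
  "diagonal m k = {x \<in> hcube m k. m dvd (\<Sum>i<k. x i)}"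

lemma dvd_sum_less_unique:
  fixes a b s m :: nat
  assumes "m dvd s + a" "m dvd s + b" "a < m" "b < m"
  shows "a = b"
proof -
  have "m dvd a - b" "m dvd b - a"
    using dvd_diff_nat[OF assms(1,2)] dvd_diff_nat[OF assms(2,1)] by simp_all
  then have "a - b = 0" "b - a = 0"
    using assms(3,4) by (meson dvd_imp_le gr0I less_imp_diff_less not_le)+
  then show ?thesis by simp
qed

text \<open>The congruence determines the last coordinate from the others, so forgetting it is
  injective.\<close>

lemma card_diagonal_le:
  assumes "1 \<le> k"
  shows "card (diagonal m k) \<le> m ^ (k - 1)"
proof -
  obtain j where j: "k = Suc j" using assms by (cases k) auto
  have "inj_on (\<lambda>x. restrict x {..<j}) (diagonal m k)"
  proof (rule inj_onI)
    fix x y assume x: "x \<in> diagonal m k" and y: "y \<in> diagonal m k"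
      and eq: "restrict x {..<j} = restrict y {..<j}"
    have less: "x i = y i" if "i < j" for i
      using fun_cong[OF eq, of i] that by simp
    then have "(\<Sum>i<j. x i) = (\<Sum>i<j. y i)" by simp
    with x y have "m dvd (\<Sum>i<j. y i) + x j" "m dvd (\<Sum>i<j. y i) + y j"
      by (simp_all add: diagonal_def j)
    moreover have "x j < m" "y j < m"
      using x y hcube_less[of _ m k j] by (simp_all add: diagonal_def j)
    ultimately have "x j = y j" by (rule dvd_sum_less_unique)
    with less have "x i = y i" if "i < k" for i
      using that by (auto simp: j less_Suc_eq)
    with x y show "x = y"
      by (intro hcube_eqI[of x m k y m]) (simp_all add: diagonal_def)
  qed
  moreover have "(\<lambda>x. restrict x {..<j}) ` diagonal m k \<subseteq> hcube m j"
    using hcube_less[of _ m k] by (fastforce simp: diagonal_def j hcube_def[of m j])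
  ultimately have "card (diagonal m k) \<le> card (hcube m j)"
    by (rule card_inj_on_le) simp
  then show ?thesis by (simp add: card_hcube j)
qed

lemma diagonal_meets_line:
  assumes "y \<in> hcube m k" "d < k" "m > 0"
  obtains a where "y(d := a) \<in> diagonal m k"
proof -
  define s where "s = (\<Sum>i\<in>{..<k} - {d}. y i)"
  \<comment> \<open>This is \<open>-s\<close> modulo \<open>m\<close>; the outer \<open>mod\<close>
    matters when \<open>m\<close> divides \<open>s\<close>.\<close>
  define a where "a = (m - s mod m) mod m"
  have "(s + a) mod m = (s mod m + (m - s mod m)) mod m"
    unfolding a_def by (simp add: mod_simps)
  also have "\<dots> = 0" using assms by (simp add: less_imp_le)
  finally have "m dvd s + a" by (simp add: dvd_eq_mod_eq_0)
  moreover have "(\<Sum>i<k. (y(d := a)) i) = a + s"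
    using assms unfolding s_def by (subst sum.remove[of _ d]) (auto intro!: sum.cong)
  moreover have "a < m" using assms by (simp add: a_def)
  ultimately have "y(d := a) \<in> diagonal m k"
    using assms by (simp add: diagonal_def hcube_upd add.commute)
  with that show thesis .
qed

text \<open>Split each coordinate of the large cube into residue and quotient modulo
  \<open>n\<close>, and copy every small rook once per diagonal vector of quotients. If the residues
  of a point are covered along \<open>d\<close>, its quotient in coordinate \<open>d\<close> may be
  changed freely, which suffices to reach the diagonal.\<close>

lemma min_rooks_spread:
  assumes l: "1 \<le> l" "l \<le> k" and n: "1 \<le> n" "n \<le> N"
  shows "min_rooks N k l \<le> (N div n + 1) ^ (k - 1) * min_rooks n k l"
proof -
  \<comment> \<open>The extra 1 makes room for the last, possibly incomplete block of length
    \<open>n\<close>.\<close>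
  define m where "m = N div n + 1"
  obtain R where R: "rook_covering n k l R" and cR: "card R = min_rooks n k l"
    using min_rooks_attained l by blast
  have sub: "R \<subseteq> rooks n k l" and inj: "inj_on fst R"
    and cov: "(\<Union>r\<in>R. covered n k r) = hcube n k"
    using R by (auto simp: rook_covering_def)
  have finR: "finite R" using sub finite_rooks by (rule finite_subset)
  define place where "place = (\<lambda>P x. \<lambda>i\<in>{..<k}. spread n N (P i) (x i))"
  define f where "f = (\<lambda>((P, D), x). (place P x, D :: nat set))"
  define R' where "R' = f ` (R \<times> diagonal m k)"
  have place: "place P x \<in> hcube N k" if "P \<in> hcube n k" for P x
    using that n by (auto simp: place_def hcube_def intro!: spread_less)
  have place_inj: "P = P'" if "P \<in> hcube n k" "P' \<in> hcube n k" "place P x = place P' x'" for P P' x x'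
  proof (rule hcube_eqI[OF that(1,2)])
    fix i assume "i < k"
    with fun_cong[OF that(3), of i] have "spread n N (P i) (x i) mod n = spread n N (P' i) (x' i) mod n"
      by (simp add: place_def)
    with \<open>i < k\<close> show "P i = P' i"
      using hcube_less[OF that(1)] hcube_less[OF that(2)] by (simp add: spread_mod)
  qed
  have "R' \<subseteq> rooks N k l"
    using sub place by (fastforce simp: R'_def f_def rooks_def)
  \<comment> \<open>Copies of different rooks differ in their residues. Copies of one rook may
    coincide through the fallback value of \<open>spread\<close>, but then they carry the same
    \<open>D\<close> and are one rook.\<close>
  moreover have "inj_on fst R'"
  proof (rule inj_onI)
    fix r r' assume "r \<in> R'" "r' \<in> R'" and eq: "fst r = fst r'"
    obtain P D x where r: "(P, D) \<in> R" "r = (place P x, D)"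
      using \<open>r \<in> R'\<close> by (auto simp: R'_def f_def)
    obtain P' D' x' where r': "(P', D') \<in> R" "r' = (place P' x', D')"
      using \<open>r' \<in> R'\<close> by (auto simp: R'_def f_def)
    have "P \<in> hcube n k" "P' \<in> hcube n k"
      using r(1) r'(1) sub by (auto simp: rooks_def)
    moreover have "place P x = place P' x'" using eq r(2) r'(2) by simp
    ultimately have "P = P'" by (rule place_inj)
    with inj_onD[OF inj, of "(P, D)" "(P', D')"] r r' have "D = D'" by simp
    with r r' eq show "r = r'" by simp
  qed
  moreover have "(\<Union>r\<in>R'. covered N k r) = hcube N k"
  proof
    show "(\<Union>r\<in>R'. covered N k r) \<subseteq> hcube N k" by (auto simp: covered_def)
    show "hcube N k \<subseteq> (\<Union>r\<in>R'. covered N k r)"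
    proof
      fix T assume T: "T \<in> hcube N k"
      define Q where "Q = (\<lambda>i\<in>{..<k}. T i mod n)"
      define y where "y = (\<lambda>i\<in>{..<k}. T i div n)"
      have Q: "Q \<in> hcube n k" using n by (auto simp: Q_def hcube_def)
      have "T i div n < m" if "i < k" for i
        using hcube_less[OF T that] by (simp add: m_def less_Suc_eq_le div_le_mono)
      then have y: "y \<in> hcube m k" by (auto simp: y_def hcube_def)
      from Q cov obtain P D where PD: "(P, D) \<in> R" "Q \<in> covered n k (P, D)" by fastforce
      have P: "P \<in> hcube n k" and D: "D \<subseteq> {..<k}" "D \<noteq> {}"
        using PD sub l by (auto simp: rooks_def)
      obtain d where d: "d \<in> D" "P = Q(d := P d)"
        using PD(2) covered_iff[OF P Q D] by blast
      have "d < k" using d D by auto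
      then obtain a where a: "y(d := a) \<in> diagonal m k"
        using diagonal_meets_line[OF y] by (auto simp: m_def)
      define S where "S = place P (y(d := a))"
      \<comment> \<open>Away from \<open>d\<close> the quotients of \<open>T\<close> are kept, so
        \<open>spread\<close> rebuilds \<open>T\<close>. In coordinate \<open>d\<close> a fallback
        value does no harm.\<close>
      have off: "S i = T i" if "i < k" "i \<noteq> d" for i
      proof -
        have "P i = T i mod n" using d(2) that by (metis (no_types) Q_def fun_upd_other lessThan_iff restrict_apply')
        then show ?thesis
          using that hcube_less[OF T] by (simp add: S_def place_def y_def spread_mod_div)
      qed
      have S: "S \<in> hcube N k" using place P by (simp add: S_def)
      have "T(d := S d) \<in> hcube N k"
        using T \<open>d < k\<close> hcube_less[OF S \<open>d < k\<close>] by (rule hcube_upd)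
      with S have "S = T(d := S d)"
        by (rule hcube_eqI) (simp add: off)
      then have "T \<in> covered N k (S, D)"
        using covered_iff[OF S T D] d(1) by blast
      moreover have "(S, D) \<in> R'"
        using PD(1) a by (force simp: R'_def f_def S_def)
      ultimately show "T \<in> (\<Union>r\<in>R'. covered N k r)" by blast
    qed
  qed
  ultimately have "rook_covering N k l R'" by (simp add: rook_covering_def)
  then have "min_rooks N k l \<le> card R'" by (rule min_rooks_le)
  also have "\<dots> \<le> card (R \<times> diagonal m k)"
    unfolding R'_def using finR by (intro card_image_le) (auto simp: diagonal_def)
  also have "\<dots> = card (diagonal m k) * min_rooks n k l"
    by (simp add: card_cartesian_product cR)
  also have "\<dots> \<le> m ^ (k - 1) * min_rooks n k l"
    using card_diagonal_le l by (intro mult_right_mono) auto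
  finally show ?thesis by (simp add: m_def)
qed

section \<open>Convergence to the infimum\<close>

text \<open>A Fekete-type argument: one term close to the infimum controls all late terms, since the
  factor \<open>g n N\<close> tends to 1.\<close>

lemma tendsto_INF_if_asymptotically_le:
  fixes f :: "nat \<Rightarrow> real" and g :: "nat \<Rightarrow> nat \<Rightarrow> real"
  assumes nonneg: "\<And>n. 0 \<le> f n"
    and le: "\<And>n N. 1 \<le> n \<Longrightarrow> n \<le> N \<Longrightarrow> f N \<le> f n * g n N"
    and g: "\<And>n. 1 \<le> n \<Longrightarrow> g n \<longlonglongrightarrow> 1"
  shows "f \<longlonglongrightarrow> (INF n\<in>{1..}. f n)"
proof (rule order_tendstoI)
  have bdd: "bdd_below (f ` {1..})" using nonneg by (intro bdd_belowI2) auto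
  fix a
  { assume "a < (INF n\<in>{1..}. f n)"
    moreover have "(INF n\<in>{1..}. f n) \<le> f n" if "1 \<le> n" for n
      using that bdd by (intro cINF_lower) auto
    ultimately have "a < f n" if "1 \<le> n" for n
      using that less_le_trans by blast
    then show "\<forall>\<^sub>F n in sequentially. a < f n"
      unfolding eventually_sequentially by blast }
  assume "(INF n\<in>{1..}. f n) < a"
  then obtain n where n: "1 \<le> n" "f n < a"
    using cINF_less_iff[OF _ bdd] by auto
  have "(\<lambda>N. f n * g n N) \<longlonglongrightarrow> f n * 1"
    by (intro tendsto_mult tendsto_const g n)
  then have "\<forall>\<^sub>F N in sequentially. f n * g n N < a"
    using n by (intro order_tendstoD) auto
  then show "\<forall>\<^sub>F N in sequentially. f N < a"
    using eventually_ge_at_top[of n]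
    by eventually_elim (use le n in force)
qed

text \<open>Rounding \<open>N / n\<close> up in the blow-up costs a factor
  \<open>(1 + n / N) ^ (k - 1)\<close>, which tends to 1. Hence a lower bound valid for every single
  \<open>n\<close> passes to the limit.\<close>

lemma rook_density_eq_INF:
  assumes l: "1 \<le> l" "l \<le> k"
  shows "rook_density k l = (INF n\<in>{1..}. real (min_rooks n k l) / real n ^ (k - 1))"
  unfolding rook_density_def
proof (rule limI,
    rule tendsto_INF_if_asymptotically_le[where g = "\<lambda>n N. (1 + real n / real N) ^ (k - 1)"])
  fix n N :: nat assume n: "1 \<le> n" "n \<le> N"
  have "real (N div n) \<le> real N / real n"
    by (rule of_nat_div_le_of_nat)
  then have q: "(real (N div n) + 1) \<le> (1 + real n / real N) * real N / real n"
    using n by (simp add: field_simps)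
  have "real (min_rooks N k l) \<le> (real (N div n) + 1) ^ (k - 1) * real (min_rooks n k l)"
    using min_rooks_spread[OF l n] by (metis (mono_tags) of_nat_1 of_nat_add of_nat_le_iff of_nat_mult of_nat_power)
  also have "\<dots> \<le> ((1 + real n / real N) * real N / real n) ^ (k - 1) * real (min_rooks n k l)"
    using q by (intro mult_right_mono power_mono) auto
  also have "\<dots> = real (min_rooks n k l) / real n ^ (k - 1) * (1 + real n / real N) ^ (k - 1) * real N ^ (k - 1)"
    by (simp add: power_mult_distrib power_divide)
  finally show "real (min_rooks N k l) / real N ^ (k - 1)
      \<le> real (min_rooks n k l) / real n ^ (k - 1) * (1 + real n / real N) ^ (k - 1)"
    using n by (simp add: pos_divide_le_eq)
next
  fix n :: nat
  have "(\<lambda>N. (1 + real n / real N) ^ (k - 1)) \<longlonglongrightarrow> (1 + 0) ^ (k - 1)"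
    by (intro tendsto_intros lim_const_over_n)
  then show "(\<lambda>N. (1 + real n / real N) ^ (k - 1)) \<longlonglongrightarrow> 1" by simp
qed auto

section \<open>Counting rooks on lines and in planes\<close>

text \<open>Here \<open>S\<close> will hold the positions of all rooks of one type \<open>D\<close>.
  A rook standing on \<open>Q\<close> itself counts in every direction.\<close>

definition line_count :: "(nat \<Rightarrow> nat) set \<Rightarrow> nat \<Rightarrow> (nat \<Rightarrow> nat) \<Rightarrow> nat" where
  "line_count S d Q = card {P \<in> S. P = Q(d := P d)}"

abbreviation line_hit :: "(nat \<Rightarrow> nat) set \<Rightarrow> nat \<Rightarrow> (nat \<Rightarrow> nat) \<Rightarrow> real" where
  "line_hit S d Q \<equiv> of_bool (0 < line_count S d Q)"

text \<open>Exchanging \<open>Q d\<close> with \<open>a\<close> is an involution on the pairs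
  \<open>(Q, a)\<close>.\<close>

lemma sum_hcube_upd:
  fixes h :: "(nat \<Rightarrow> nat) \<Rightarrow> real"
  assumes "d < k"
  shows "(\<Sum>Q\<in>hcube n k. \<Sum>a<n. h (Q(d := a))) = real n * (\<Sum>Q\<in>hcube n k. h Q)"
proof -
  have "(\<Sum>Q\<in>hcube n k. \<Sum>a<n. h (Q(d := a)))
      = (\<Sum>(Q, a)\<in>hcube n k \<times> {..<n}. h (Q(d := a)))"
    by (rule sum.cartesian_product)
  also have "\<dots> = (\<Sum>(Q, a)\<in>hcube n k \<times> {..<n}. h Q)"
    by (rule sum.reindex_bij_witness[where i = "\<lambda>(Q, a). (Q(d := a), Q d)"
          and j = "\<lambda>(Q, a). (Q(d := a), Q d)"])
      (auto simp: hcube_upd hcube_less assms)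
  also have "\<dots> = (\<Sum>Q\<in>hcube n k. \<Sum>a<n. h Q)"
    by (rule sum.cartesian_product [symmetric])
  finally show ?thesis by (simp add: sum_distrib_left)
qed

text \<open>Line averaging in two directions: the plane sums add up to \<open>n * n\<close> times
  the full sum.\<close>

lemma sum_hcube_nonneg_if_planes:
  fixes h :: "(nat \<Rightarrow> nat) \<Rightarrow> real"
  assumes "d < k" "d' < k" "0 < n"
    and planes: "\<And>Q. Q \<in> hcube n k \<Longrightarrow> 0 \<le> (\<Sum>a<n. \<Sum>b<n. h (Q(d := a, d' := b)))"
  shows "0 \<le> (\<Sum>Q\<in>hcube n k. h Q)"
proof -
  have "0 \<le> (\<Sum>Q\<in>hcube n k. \<Sum>a<n. \<Sum>b<n. h (Q(d := a, d' := b)))"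
    by (intro sum_nonneg planes)
  also have "\<dots> = real n * (\<Sum>Q\<in>hcube n k. \<Sum>b<n. h (Q(d' := b)))"
    by (rule sum_hcube_upd) fact
  also have "\<dots> = real n * (real n * (\<Sum>Q\<in>hcube n k. h Q))"
    by (simp only: sum_hcube_upd[OF assms(2)])
  finally show ?thesis using assms by (simp add: zero_le_mult_iff)
qed

text \<open>Double counting: each \<open>P\<close> is seen along direction \<open>d\<close> from
  exactly \<open>n\<close> points.\<close>

lemma sum_line_count:
  assumes "S \<subseteq> hcube n k" "d < k"
  shows "(\<Sum>Q\<in>hcube n k. real (line_count S d Q)) = real n * real (card S)"
proof -
  have fin: "finite S" using assms finite_hcube finite_subset by metis
  have fibre: "card {Q \<in> hcube n k. P = Q(d := P d)} = n" if "P \<in> S" for P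
  proof -
    have P: "P \<in> hcube n k" using that assms by auto
    have "{Q \<in> hcube n k. P = Q(d := P d)} = (\<lambda>a. P(d := a)) ` {..<n}"
    proof (intro set_eqI iffI)
      fix Q assume Q: "Q \<in> {Q \<in> hcube n k. P = Q(d := P d)}"
      then have "Q = P(d := Q d)" by (metis (mono_tags, lifting) fun_upd_triv fun_upd_upd mem_Collect_eq)
      with Q assms show "Q \<in> (\<lambda>a. P(d := a)) ` {..<n}" by (auto intro: hcube_less)
    next
      fix Q assume "Q \<in> (\<lambda>a. P(d := a)) ` {..<n}"
      with P assms show "Q \<in> {Q \<in> hcube n k. P = Q(d := P d)}" by (auto intro: hcube_upd)
    qed
    moreover have "inj_on (\<lambda>a. P(d := a)) {..<n}"
      by (metis fun_upd_same inj_onI)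
    ultimately show ?thesis by (simp add: card_image)
  qed
  have "(\<Sum>Q\<in>hcube n k. line_count S d Q) = (\<Sum>P\<in>S. card {Q \<in> hcube n k. P = Q(d := P d)})"
    unfolding line_count_def using fin by (intro sum_multicount_gen[symmetric]) auto
  also have "\<dots> = n * card S" using fibre by simp
  finally show ?thesis by (metis of_nat_mult of_nat_sum)
qed

text \<open>A plane section of side \<open>n\<close> contains \<open>m\<close> rooks of one type, lying on \<open>u\<close> rows and
  \<open>v\<close> columns. The bound is the tangent line at \<open>m = z n\<close> to \<open>2 m\<^sup>2\<close>.\<close>

lemma plane_inequality_aux:
  fixes u v m n z c :: real
  assumes "0 \<le> v" "v \<le> u" "u \<le> m" "u \<le> n" "0 \<le> c" "2 * z \<le> c" "0 \<le> c - 4 * z + 2 * z\<^sup>2"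
  shows "0 \<le> 2 * u * v + c * n * (2 * m - u - v) - 4 * z * n * m + 2 * z\<^sup>2 * n\<^sup>2"
proof -
  have n: "0 \<le> n" and u: "0 \<le> u" using assms by linarith+
  \<comment> \<open>The expression is nondecreasing in \<open>m\<close>, so it remains to treat
    \<open>m = u\<close>.\<close>
  have "0 \<le> (2 * c - 4 * z) * n * (m - u)" using assms n by simp
  moreover have "0 \<le> 2 * u * v + c * n * (u - v) - 4 * z * n * u + 2 * z\<^sup>2 * n\<^sup>2"
  \<comment> \<open>What is left is linear in \<open>v\<close> with slope
    \<open>2 * u - c * n\<close>. A negative slope is worst at \<open>v = u\<close>, leaving a
    square; otherwise \<open>v = 0\<close> is worst.\<close>
  proof (cases "2 * u < c * n")
    case True
    then have "0 \<le> (c * n - 2 * u) * (u - v)" using assms by simp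
    moreover have "0 \<le> 2 * (u - z * n)\<^sup>2" by simp
    ultimately show ?thesis by (simp add: algebra_simps power2_eq_square)
  next
    case False
    then have "0 \<le> (2 * u - c * n) * v" using assms by simp
    \<comment> \<open>The bracket is linear in \<open>u\<close>, so only the ends
      \<open>u = 0\<close> and \<open>u = n\<close> matter; the second is the hypothesis on
      \<open>c\<close> and \<open>z\<close>.\<close>
    moreover have "0 \<le> n * ((c - 4 * z) * u + 2 * z\<^sup>2 * n)"
    proof (cases "0 \<le> c - 4 * z")
      case True
      with n u show ?thesis by simp
    next
      case False
      then have "(c - 4 * z) * n \<le> (c - 4 * z) * u" using assms by (simp add: mult_left_mono_neg)
      moreover have "0 \<le> (c - 4 * z + 2 * z\<^sup>2) * n" using assms n by (intro mult_nonneg_nonneg)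
      ultimately have "0 \<le> (c - 4 * z) * u + 2 * z\<^sup>2 * n" by (simp add: algebra_simps)
      with n show ?thesis by simp
    qed
    ultimately show ?thesis by (simp add: algebra_simps power2_eq_square)
  qed
  ultimately show ?thesis by (simp add: algebra_simps)
qed

lemma plane_inequality:
  fixes u v m n z c :: real
  assumes "0 \<le> u" "0 \<le> v" "u \<le> m" "v \<le> m" "u \<le> n" "v \<le> n"
    and "0 \<le> c" "2 * z \<le> c" "0 \<le> c - 4 * z + 2 * z\<^sup>2"
  shows "0 \<le> 2 * u * v + c * n * (2 * m - u - v) - 4 * z * n * m + 2 * z\<^sup>2 * n\<^sup>2"
  using plane_inequality_aux[of v u m n c z] plane_inequality_aux[of u v m n c z] assms
  by (cases "v \<le> u") (simp_all add: algebra_simps)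

text \<open>The functions \<open>r\<close> and \<open>s\<close> are the two marginals of the
  \<open>m\<close> rooks in a plane. The double sum separates: the product gives
  \<open>2 * u * v\<close>, and terms in one variable gain a factor \<open>n\<close>.\<close>

lemma plane_sum_nonneg:
  fixes r s :: "nat \<Rightarrow> nat" and z c :: real
  assumes m: "(\<Sum>a<n. r a) = m" "(\<Sum>a<n. s a) = m"
    and c: "0 \<le> c" "2 * z \<le> c" "0 \<le> c - 4 * z + 2 * z\<^sup>2"
  shows "0 \<le> (\<Sum>a<n. \<Sum>b<n. 2 * (of_bool (0 < r b) * of_bool (0 < s a))
      + c * ((real (r b) - of_bool (0 < r b)) + (real (s a) - of_bool (0 < s a)))
      - 2 * z * (real (r b) + real (s a)) + 2 * z\<^sup>2)"
proof -
  define u v :: real where "u = (\<Sum>b<n. of_bool (0 < r b))" and "v = (\<Sum>a<n. of_bool (0 < s a))"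
  have mr: "(\<Sum>b<n. real (r b)) = real m" "(\<Sum>a<n. real (s a)) = real m"
    using m by (metis of_nat_sum)+
  have "u \<le> (\<Sum>b<n. real (r b))" "v \<le> (\<Sum>b<n. real (s b))"
    unfolding u_def v_def by (intro sum_mono; simp)+
  moreover have "u \<le> (\<Sum>b<n. 1)" "v \<le> (\<Sum>b<n. 1)"
    unfolding u_def v_def by (intro sum_mono; simp)+
  moreover have "0 \<le> u" "0 \<le> v"
    unfolding u_def v_def by (intro sum_nonneg; simp)+
  ultimately have "0 \<le> 2 * u * v + c * real n * (2 * real m - u - v)
      - 4 * z * real n * real m + 2 * z\<^sup>2 * (real n)\<^sup>2"
    using c by (intro plane_inequality) (simp_all add: mr)
  also have "\<dots> = (\<Sum>a<n. \<Sum>b<n. 2 * (of_bool (0 < r b) * of_bool (0 < s a))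
      + c * ((real (r b) - of_bool (0 < r b)) + (real (s a) - of_bool (0 < s a)))
      - 2 * z * (real (r b) + real (s a)) + 2 * z\<^sup>2)"
    by (simp add: sum.distrib sum_subtractf mr power2_eq_square
        flip: sum_distrib_left sum_distrib_right u_def v_def) (simp add: algebra_simps)
  finally show ?thesis .
qed

lemma sum_card_fibres:
  fixes f :: "'a \<Rightarrow> nat"
  assumes "finite S" "\<And>P. P \<in> S \<Longrightarrow> f P < n"
  shows "(\<Sum>a<n. card {P \<in> S. f P = a}) = card S"
  using sum.group[of S "{..<n}" f "\<lambda>_. 1 :: nat"] assms by (simp add: image_subset_iff)

text \<open>The plane inequality summed over all planes. With density \<open>t\<close> of
  \<open>S\<close> per \<open>n ^ (k - 1)\<close>, the left side is \<open>n ^ k\<close> times the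
  tangent \<open>2 * z * t - z\<^sup>2\<close> to \<open>t\<^sup>2\<close>; being linear in
  \<open>card S\<close>, it can be added over types with a common \<open>z\<close>, which replaces a
  convexity argument.\<close>

lemma sum_line_hits_ge:
  fixes z c :: real
  assumes S: "S \<subseteq> hcube n k" and d: "d < k" "d' < k" "d \<noteq> d'" and n: "0 < n"
    and c: "0 \<le> c" "2 * z \<le> c" "0 \<le> c - 4 * z + 2 * z\<^sup>2"
  shows "2 * z * real n * real (card S) - z\<^sup>2 * real n ^ k
      \<le> (\<Sum>Q\<in>hcube n k. line_hit S d Q * line_hit S d' Q
          + c / 2 * ((real (line_count S d Q) - line_hit S d Q)
                    + (real (line_count S d' Q) - line_hit S d' Q)))"
proof -
  define G where "G = (\<lambda>Q. line_hit S d Q * line_hit S d' Q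
          + c / 2 * ((real (line_count S d Q) - line_hit S d Q)
                    + (real (line_count S d' Q) - line_hit S d' Q)))"
  define h where "h = (\<lambda>Q. 2 * G Q
          - 2 * z * (real (line_count S d Q) + real (line_count S d' Q)) + 2 * z\<^sup>2)"
  have h_eq: "h Q = 2 * (line_hit S d Q * line_hit S d' Q)
          + c * ((real (line_count S d Q) - line_hit S d Q)
                    + (real (line_count S d' Q) - line_hit S d' Q))
          - 2 * z * (real (line_count S d Q) + real (line_count S d' Q)) + 2 * z\<^sup>2" for Q
    by (simp add: h_def G_def distrib_left)
  have fin: "finite S" using S finite_hcube finite_subset by metis
  have "0 \<le> (\<Sum>Q\<in>hcube n k. h Q)"
  proof (rule sum_hcube_nonneg_if_planes[OF d(1,2) n])
    fix Q
    define S' where "S' = {P \<in> S. P = Q(d := P d, d' := P d')}"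
    \<comment> \<open>Within a plane, a line in direction \<open>d\<close> is a fibre of the other
      coordinate \<open>d'\<close>, and conversely.\<close>
    have "line_count S d (Q(d := a, d' := b)) = card {P \<in> S'. P d' = b}"
      and "line_count S d' (Q(d := a, d' := b)) = card {P \<in> S'. P d = a}" for a b
      unfolding line_count_def S'_def using d(3)
      by (intro arg_cong[where f = card] Collect_cong; simp add: fun_eq_iff; metis)+
    moreover have "(\<Sum>a<n. card {P \<in> S'. P d = a}) = card S'"
      "(\<Sum>a<n. card {P \<in> S'. P d' = a}) = card S'"
      using S d fin by (intro sum_card_fibres; auto simp: S'_def intro: hcube_less)+
    ultimately show "0 \<le> (\<Sum>a<n. \<Sum>b<n. h (Q(d := a, d' := b)))"
      unfolding h_eq using plane_sum_nonneg[OF _ _ c] by simp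
  qed
  also have "\<dots> = 2 * ((\<Sum>Q\<in>hcube n k. G Q) - 2 * z * real n * real (card S) + z\<^sup>2 * real n ^ k)"
    unfolding h_def
    by (simp add: sum.distrib sum_subtractf sum_line_count[OF S] d card_hcube
        flip: sum_distrib_left)
  finally show ?thesis by (simp add: G_def)
qed

section \<open>The excess of a covering\<close>

text \<open>With \<open>b\<close> lines hit and surplus \<open>W\<close> on these lines, the left
  side is \<open>b * (b - 1) + c * (l - 1) * W\<close>. If \<open>b\<close> is positive, then
  \<open>b - 1\<close> is the excess without the surplus and \<open>b\<close> is at most
  \<open>l\<close>; the bound on \<open>c\<close> handles \<open>W\<close>.\<close>

lemma sum_pairs_le_excess:
  fixes A :: "nat \<Rightarrow> nat" and c :: real
  assumes D: "finite D" "card D = l" and c: "c * (real l - 1) \<le> real l"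
  shows "(\<Sum>d\<in>D. \<Sum>d'\<in>D - {d}. of_bool (0 < A d) * of_bool (0 < A d')
        + c / 2 * ((real (A d) - of_bool (0 < A d)) + (real (A d') - of_bool (0 < A d'))))
      \<le> real l * ((\<Sum>d\<in>D. real (A d)) - of_bool (\<exists>d\<in>D. 0 < A d))"
proof -
  define B where "B = (\<lambda>d. of_bool (0 < A d) :: real)"
  define w where "w = (\<lambda>d. real (A d) - B d)"
  define b where "b = (\<Sum>d\<in>D. B d)"
  define W where "W = (\<Sum>d\<in>D. w d)"
  define e where "e = c / 2"
  \<comment> \<open>The diagonal terms are added and subtracted; \<open>B d * B d = B d\<close> as
    \<open>B\<close> takes the values 0 and 1.\<close>
  have "(\<Sum>d\<in>D. \<Sum>d'\<in>D - {d}. B d * B d' + e * (w d + w d'))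
      = (\<Sum>d\<in>D. (\<Sum>d'\<in>D. B d * B d' + e * (w d + w d')) - (B d + 2 * e * w d))"
    using D by (intro sum.cong) (auto simp: sum_diff1 B_def)
  also have "\<dots> = b * b - b + 2 * e * (real l - 1) * W"
    using D by (simp add: sum.distrib sum_subtractf b_def W_def
        flip: sum_distrib_left sum_distrib_right) (simp add: algebra_simps)
  also have "\<dots> = b * b - b + c * (real l - 1) * W" by (simp add: e_def)
  also have "\<dots> \<le> b * b - b + real l * W"
  proof -
    have "0 \<le> W" unfolding W_def by (intro sum_nonneg) (auto simp: w_def B_def)
    with c show ?thesis by (simp add: mult_right_mono)
  qed
  also have "b * b - b \<le> real l * (b - of_bool (\<exists>d\<in>D. 0 < A d))"
  proof (cases "\<exists>d\<in>D. 0 < A d")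
    case True
    then obtain d where d: "d \<in> D" "0 < A d" by blast
    have "b \<le> (\<Sum>d\<in>D. 1)" unfolding b_def by (intro sum_mono) (simp add: B_def)
    then have "b \<le> l" using D by simp
    moreover have "B d \<le> b" unfolding b_def using d D by (intro member_le_sum) (auto simp: B_def)
    then have "1 \<le> b" using d by (simp add: B_def)
    ultimately have "b * (b - 1) \<le> l * (b - 1)" by (intro mult_right_mono) auto
    with True show ?thesis by (simp add: algebra_simps)
  next
    case False
    then have "b = 0" by (simp add: b_def B_def)
    with False show ?thesis by simp
  qed
  also have "real l * (b - of_bool (\<exists>d\<in>D. 0 < A d)) + real l * W
      = real l * ((\<Sum>d\<in>D. real (A d)) - of_bool (\<exists>d\<in>D. 0 < A d))"
    by (simp add: W_def w_def b_def sum_subtractf algebra_simps)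
  finally show ?thesis by (simp only: B_def w_def e_def)
qed

text \<open>The sum of \<open>F\<close> over points, types and ordered pairs of directions is
  bounded below plane by plane and above point by point. Covering enters through the 1 subtracted at
  each point, which some type must hit.\<close>

lemma covering_inequality:
  fixes z c :: real
  assumes R: "rook_covering n k l R" and l: "1 \<le> l" and n: "0 < n"
    and c: "0 \<le> c" "2 * z \<le> c" "0 \<le> c - 4 * z + 2 * z\<^sup>2" "c * (real l - 1) \<le> real l"
  shows "(real l - 1) * (2 * z * real n * real (card R) - real (k choose l) * z\<^sup>2 * real n ^ k)
      \<le> real l * real n * real (card R) - real n ^ k"
proof -
  define T where "T = {D. D \<subseteq> {..<k} \<and> card D = l}"
  define S where "S = (\<lambda>D. {P. (P, D) \<in> R})"
  have sub: "R \<subseteq> hcube n k \<times> T" and cov: "(\<Union>r\<in>R. covered n k r) = hcube n k"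
    using R by (auto simp: rook_covering_def rooks_def T_def)
  have T: "finite T" "card T = k choose l"
    using n_subsets[of "{..<k}" l] by (auto simp: T_def)
  have S: "S D \<subseteq> hcube n k" for D using sub by (auto simp: S_def)
  have finS: "finite (S D)" for D using S finite_hcube finite_subset by metis
  have finD: "finite D" "card D = l" "D \<subseteq> {..<k}" if "D \<in> T" for D
    using that finite_subset by (auto simp: T_def)
  have "R = (\<lambda>(D, P). (P, D)) ` Sigma T S"
    using sub by (force simp: S_def)
  then have "card R = card (Sigma T S)"
    by (simp add: card_image inj_on_def)
  then have cR: "(\<Sum>D\<in>T. real (card (S D))) = real (card R)"
    using T finS by (simp add: card_SigmaI)
  define A where "A = (\<lambda>Q D d. line_count (S D) d Q)"
  define F where "F = (\<lambda>Q D d d'. of_bool (0 < A Q D d) * of_bool (0 < A Q D d')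
        + c / 2 * ((real (A Q D d) - of_bool (0 < A Q D d)) + (real (A Q D d') - of_bool (0 < A Q D d'))))"
  have point: "(\<Sum>D\<in>T. \<Sum>d\<in>D. \<Sum>d'\<in>D - {d}. F Q D d d')
      \<le> real l * ((\<Sum>D\<in>T. \<Sum>d\<in>D. real (A Q D d)) - 1)" if Q: "Q \<in> hcube n k" for Q
  proof -
    from Q cov obtain P D where PD: "(P, D) \<in> R" "Q \<in> covered n k (P, D)" by fastforce
    then have P: "P \<in> hcube n k" and D: "D \<in> T" using sub by auto
    have "D \<noteq> {}" using finD[OF D] l by auto
    then obtain d where d: "d \<in> D" "P = Q(d := P d)"
      using PD(2) covered_iff[OF P Q] finD[OF D] by blast
    then have "P \<in> {P \<in> S D. P = Q(d := P d)}" using PD(1) by (simp add: S_def)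
    then have "0 < A Q D d"
      unfolding A_def line_count_def using finS by (auto simp: card_gt_0_iff)
    with d D have "1 \<le> (of_bool (\<exists>d\<in>D. 0 < A Q D d) :: real)" by auto
    also have "\<dots> \<le> (\<Sum>D\<in>T. of_bool (\<exists>d\<in>D. 0 < A Q D d))"
      using D T by (intro member_le_sum) auto
    finally have hit: "1 \<le> (\<Sum>D\<in>T. of_bool (\<exists>d\<in>D. 0 < A Q D d) :: real)" .
    have "(\<Sum>D\<in>T. \<Sum>d\<in>D. \<Sum>d'\<in>D - {d}. F Q D d d')
        \<le> (\<Sum>D\<in>T. real l * ((\<Sum>d\<in>D. real (A Q D d)) - of_bool (\<exists>d\<in>D. 0 < A Q D d)))"
      unfolding F_def using finD c(4) by (intro sum_mono sum_pairs_le_excess) auto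
    also have "\<dots> = real l * ((\<Sum>D\<in>T. \<Sum>d\<in>D. real (A Q D d)) - (\<Sum>D\<in>T. of_bool (\<exists>d\<in>D. 0 < A Q D d)))"
      by (simp add: sum_subtractf flip: sum_distrib_left)
    also have "\<dots> \<le> real l * ((\<Sum>D\<in>T. \<Sum>d\<in>D. real (A Q D d)) - 1)"
      using hit by (intro mult_left_mono) auto
    finally show ?thesis .
  qed
  \<comment> \<open>Each type has \<open>l * (l - 1)\<close> ordered pairs of distinct directions;
    the factor \<open>l\<close> cancels at the end.\<close>
  have "real l * ((real l - 1) * (2 * z * real n * real (card R) - real (k choose l) * z\<^sup>2 * real n ^ k))
      = (\<Sum>D\<in>T. real l * ((real l - 1) * (2 * z * real n * real (card (S D)) - z\<^sup>2 * real n ^ k)))"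
    by (simp add: sum_subtractf T cR flip: sum_distrib_left)
  also have "\<dots> = (\<Sum>D\<in>T. \<Sum>d\<in>D. \<Sum>d'\<in>D - {d}. 2 * z * real n * real (card (S D)) - z\<^sup>2 * real n ^ k)"
    using finD l by (intro sum.cong) (auto simp: card_Diff_singleton of_nat_diff)
  also have "\<dots> \<le> (\<Sum>D\<in>T. \<Sum>d\<in>D. \<Sum>d'\<in>D - {d}. \<Sum>Q\<in>hcube n k. F Q D d d')"
    unfolding F_def A_def using finD n c by (intro sum_mono sum_line_hits_ge S) auto
  also have "\<dots> = (\<Sum>Q\<in>hcube n k. \<Sum>D\<in>T. \<Sum>d\<in>D. \<Sum>d'\<in>D - {d}. F Q D d d')"
    by (simp only: sum.swap[where A = "hcube n k"])
  also have "\<dots> \<le> (\<Sum>Q\<in>hcube n k. real l * ((\<Sum>D\<in>T. \<Sum>d\<in>D. real (A Q D d)) - 1))"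
    by (intro sum_mono point)
  also have "\<dots> = real l * ((\<Sum>D\<in>T. \<Sum>d\<in>D. \<Sum>Q\<in>hcube n k. real (A Q D d)) - real n ^ k)"
    by (simp add: sum_subtractf card_hcube sum.swap[where A = "hcube n k"] flip: sum_distrib_left)
  also have "(\<Sum>D\<in>T. \<Sum>d\<in>D. \<Sum>Q\<in>hcube n k. real (A Q D d)) = (\<Sum>D\<in>T. \<Sum>d\<in>D. real n * real (card (S D)))"
    unfolding A_def using finD by (intro sum.cong refl sum_line_count S) auto
  also have "\<dots> = (\<Sum>D\<in>T. real l * real n * real (card (S D)))"
    using finD by (intro sum.cong) auto
  also have "\<dots> = real l * real n * real (card R)"
    by (simp add: cR flip: sum_distrib_left)
  finally show ?thesis using l by simp
qed

section \<open>From the excess to the density\<close>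

lemma covering_density_quadratic:
  assumes R: "rook_covering n k l R" and l: "1 \<le> l" "l \<le> k" and n: "0 < n"
    and x: "x = real (card R) / real n ^ (k - 1)" "x * (real l - 1) \<le> 1"
  shows "(real l - 1) * x\<^sup>2 / real (k choose l) \<le> real l * x - 1"
proof -
  define C where "C = real (k choose l)"
  have C: "1 \<le> C" using l by (simp add: C_def Suc_le_eq zero_less_binomial)
  have x0: "0 \<le> x" by (simp add: x)
  have "real n ^ k = real n * real n ^ (k - 1)" using l by (simp add: power_eq_if)
  then have nR: "real n * real (card R) = x * real n ^ k" using n by (simp add: x)
  \<comment> \<open>The average density per type maximises \<open>2 * z * x - C * z\<^sup>2\<close>,
    and \<open>c\<close> is the largest value with \<open>c * (l - 1)\<close> at most
    \<open>l\<close>. For \<open>l = 1\<close> the factor \<open>real l - 1\<close> removes these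
    terms, and 0 avoids dividing by zero.\<close>
  define z where "z = (if l = 1 then 0 else x / C)"
  define c where "c = (if l = 1 then 0 else real l / (real l - 1))"
  have "0 \<le> c" "2 * z \<le> c" "0 \<le> c - 4 * z + 2 * z\<^sup>2" "c * (real l - 1) \<le> real l"
  proof -
    define t where "t = 1 / (real l - 1)"
    have *: "0 \<le> c \<and> 2 * z \<le> c \<and> 0 \<le> c - 4 * z + 2 * z\<^sup>2 \<and> c * (real l - 1) \<le> real l" if l2: "l \<noteq> 1"
    proof -
      have ct: "c = 1 + t" using l l2 by (simp add: c_def t_def field_simps)
      have t: "0 < t" "t \<le> 1" using l l2 by (auto simp: t_def field_simps)
      have "z \<le> x" using x0 C l2 by (simp add: z_def divide_le_eq mult_le_cancel_left1)
      also have "x \<le> t" using x l l2 by (simp add: t_def field_simps)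
      finally have zt: "z \<le> t" .
      have "l = 2 \<or> 3 \<le> l" using l l2 by linarith
      \<comment> \<open>This is the value of \<open>c - 4 * z + 2 * z\<^sup>2\<close> at
        \<open>z = t\<close>. It is negative for \<open>t\<close> strictly between 1/2 and 1, so the
        integrality of \<open>l\<close> is essential.\<close>
      then have "0 \<le> (1 - t) * (1 - 2 * t)"
      proof
        assume "3 \<le> l"
        then have "t \<le> 1 / 2" by (auto simp: t_def field_simps)
        then show ?thesis by (intro mult_nonneg_nonneg) auto
      qed (simp add: t_def)
      moreover have "0 \<le> 2 * ((t - z) * (2 - t - z))" using zt t by (intro mult_nonneg_nonneg) auto
      ultimately have "0 \<le> c - 4 * z + 2 * z\<^sup>2"
        unfolding ct by (simp add: algebra_simps power2_eq_square)
      moreover have "c * (real l - 1) = real l" using l l2 by (simp add: c_def)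
      ultimately show ?thesis using zt t ct by simp
    qed
    then show "0 \<le> c" "2 * z \<le> c" "0 \<le> c - 4 * z + 2 * z\<^sup>2" "c * (real l - 1) \<le> real l"
      by (cases "l = 1"; simp add: c_def z_def)+
  qed
  then have "(real l - 1) * (2 * z * real n * real (card R) - C * z\<^sup>2 * real n ^ k)
      \<le> real l * real n * real (card R) - real n ^ k"
    unfolding C_def by (intro covering_inequality[OF R l(1) n]) auto
  then have "((real l - 1) * (2 * z * x - C * z\<^sup>2)) * real n ^ k \<le> (real l * x - 1) * real n ^ k"
    by (simp add: nR mult.assoc) (simp add: algebra_simps)
  then have "(real l - 1) * (2 * z * x - C * z\<^sup>2) \<le> real l * x - 1"
    using n by (simp add: mult_le_cancel_right)
  moreover have "(real l - 1) * (2 * z * x - C * z\<^sup>2) = (real l - 1) * x\<^sup>2 / C"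
    using C by (simp add: z_def field_simps power2_eq_square)
  ultimately show ?thesis by (simp add: C_def)
qed

lemma quadratic_root_bound:
  fixes x C l :: real
  assumes l: "1 \<le> l" and C: "1 \<le> C" and x: "0 \<le> x"
    and quad: "x * (l - 1) \<le> 1 \<Longrightarrow> (l - 1) * x\<^sup>2 / C \<le> l * x - 1"
  shows "2 / (l * (1 + sqrt (1 - 4 * (l - 1) / (l\<^sup>2 * C)))) \<le> x"
proof -
  define q where "q = 4 * (l - 1) / (l\<^sup>2 * C)"
  define s where "s = sqrt (1 - q)"
  \<comment> \<open>The extreme case \<open>C = 1\<close> makes \<open>1 - q\<close> a perfect
    square. This shows that the root is real and bounds \<open>s\<close> from below.\<close>
  have "q \<le> 4 * (l - 1) / (l\<^sup>2 * 1)"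
    unfolding q_def using l C by (intro divide_left_mono mult_left_mono) auto
  then have "1 - 4 * (l - 1) / l\<^sup>2 \<le> 1 - q" by simp
  moreover have eq: "1 - 4 * (l - 1) / l\<^sup>2 = ((l - 2) / l)\<^sup>2"
    using l by (simp add: field_simps power2_eq_square)
  ultimately have q: "((l - 2) / l)\<^sup>2 \<le> 1 - q" by simp
  then have s0: "0 \<le> s" and s2: "s\<^sup>2 = 1 - q"
    unfolding s_def using order_trans[OF zero_le_power2 q] by simp_all
  have "(l - 2) / l \<le> s" unfolding s_def using q by (rule real_le_rsqrt)
  then have ls: "2 * (l - 1) \<le> l * (1 + s)" using l by (simp add: field_simps)
  have "2 \<le> x * (l * (1 + s))"
  proof (cases "x * (l - 1) \<le> 1")
    case True
    define y where "y = l * x"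
    have "q * y\<^sup>2 / 4 = (l - 1) * x\<^sup>2 / C" using l C by (simp add: q_def y_def field_simps power2_eq_square)
    with quad[OF True] have "q * y\<^sup>2 / 4 \<le> y - 1" by (simp add: y_def)
    \<comment> \<open>The product of the two factors is not positive, so the larger one, with
      \<open>1 + s\<close>, cannot be negative.\<close>
    moreover have "((1 + s) * y - 2) * ((1 - s) * y - 2) = (1 - s\<^sup>2) * y\<^sup>2 - 4 * y + 4"
      by (simp add: algebra_simps power2_eq_square)
    ultimately have "((1 + s) * y - 2) * ((1 - s) * y - 2) \<le> 0"
      using s2 by simp
    moreover have "(1 - s) * y \<le> (1 + s) * y" using s0 x l by (intro mult_right_mono) (auto simp: y_def)
    ultimately have "2 \<le> (1 + s) * y" by (smt (verit) mult_neg_neg)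
    then show ?thesis by (simp add: y_def algebra_simps)
  next
    case False
    then have "2 \<le> x * (2 * (l - 1))" by (simp add: algebra_simps)
    also have "\<dots> \<le> x * (l * (1 + s))" using ls x by (intro mult_left_mono)
    finally show ?thesis .
  qed
  then have "2 / (l * (1 + s)) \<le> x" using l s0 by (simp add: pos_divide_le_eq)
  then show ?thesis by (simp add: s_def q_def)
qed

theorem theorem8:
  fixes l k :: nat
  assumes "1 \<le> l" and "l \<le> k"
  shows "rook_density k l \<ge>
    2 / (real l * (1 + sqrt (1 - 4 * (real l - 1) / ((real l)\<^sup>2 * real (k choose l)))))"
  unfolding rook_density_eq_INF[OF assms]
proof (rule cINF_greatest)
  fix n :: nat
  assume "n \<in> {1..}"
  obtain R where R: "rook_covering n k l R" "card R = min_rooks n k l"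
    using min_rooks_attained assms by blast
  have "1 \<le> real (k choose l)" using assms by (simp add: Suc_le_eq zero_less_binomial)
  with R \<open>n \<in> {1..}\<close> assms
  show "2 / (real l * (1 + sqrt (1 - 4 * (real l - 1) / ((real l)\<^sup>2 * real (k choose l)))))
      \<le> real (min_rooks n k l) / real n ^ (k - 1)"
    by (intro quadratic_root_bound covering_density_quadratic) auto
qed auto

end
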